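(* For any graph $H$ with $n$ vertices and $m$ edges, and for any integer $q\ge 2$, we have $s_q(H)\le (2q-1)m+2n-1+4q$.
   Context: Graphs are finite and simple. $\mathbb{Z}_q$ denotes the cyclic group of order $q$. A $\mathbb{Z}_q$-edge-weighted $K_f$ is the complete graph $K_f$ on $f$ vertices equipped with a weight function $\omega:E(K_f)\to\mathbb{Z}_q$ (arbitrary). The weight of a path is the sum in $\mathbb{Z}_q$ of the weights of its edges. A subdivision of a graph $H$ is a graph obtained from $H$ by replacing each edge of $H$ by a path (a subdivision path) of length at least $1$ with the same endpoints, where the internal vertices of these paths are new and the paths are pairwise internally disjoint. A $q$-divisible subdivision of $H$ in a $\mathbb{Z}_q$-edge-weighted $K_f$ is a subgraph of $K_f$ that is a subdivision of $H$ in which every subdivision path has weight $0$ in $\mathbb{Z}_q$. For an integer $q\ge 2$, $s_q(H)$ denotes the minimum $f$ such that every $\mathbb{Z}_q$-edge-weighted $K_f$ contains a $q$-divisible subdivision of $H$. *)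

theory Defs
  imports "HOL-Library.Extended_Nat"
begin

section \<open>Finite simple graphs\<close>

type_synonym 'a graph = "'a set \<times> 'a set set"

abbreviation verts :: "'a graph \<Rightarrow> 'a set" where "verts \<equiv> fst"
abbreviation edges :: "'a graph \<Rightarrow> 'a set set" where "edges \<equiv> snd"

definition complete_on :: "'a set \<Rightarrow> 'a graph" where
  "complete_on V = (V, {{u, v} | u v. u \<in> V \<and> v \<in> V \<and> u \<noteq> v})"

definition fin_simple_graph :: "'a graph \<Rightarrow> bool" where
  "fin_simple_graph G \<longleftrightarrow> finite (verts G) \<and> edges G \<subseteq> edges (complete_on (verts G))"

definition subgraph :: "'a graph \<Rightarrow> 'a graph \<Rightarrow> bool" where
  "subgraph G' G \<longleftrightarrow> fin_simple_graph G' \<and> verts G' \<subseteq> verts G \<and> edges G' \<subseteq> edges G"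

definition complete_K :: "nat \<Rightarrow> nat graph" where
  "complete_K f = complete_on {..<f}"

section \<open>Paths and subdivisions\<close>

text \<open>Paths are given by their vertex sequences; a path of length \<open>k\<close> has \<open>k + 1\<close> vertices.\<close>

fun path_edges :: "'a list \<Rightarrow> 'a set list" where
  "path_edges (u # v # p) = {u, v} # path_edges (v # p)"
| "path_edges _ = []"

definition is_path :: "'a graph \<Rightarrow> 'a list \<Rightarrow> bool" where
  "is_path G p \<longleftrightarrow> p \<noteq> [] \<and> distinct p \<and> set p \<subseteq> verts G \<and> set (path_edges p) \<subseteq> edges G"

definition internal_verts :: "'a list \<Rightarrow> 'a set" where
  "internal_verts p = set p - {hd p, last p}"

text \<open>
  \<open>subdivision_via H S b P\<close>: the graph \<open>S\<close> arises from \<open>H\<close>, whose vertices are placed at the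
  branch vertices given by \<open>b\<close>, by replacing each edge \<open>e\<close> of \<open>H\<close> with the path \<open>P e\<close>.
  Edges are undirected, so \<open>P e\<close> may be traversed in either direction.
\<close>

definition subdivision_via ::
    "'a graph \<Rightarrow> 'b graph \<Rightarrow> ('a \<Rightarrow> 'b) \<Rightarrow> ('a set \<Rightarrow> 'b list) \<Rightarrow> bool" where
  "subdivision_via H S b P \<longleftrightarrow>
     inj_on b (verts H) \<and>
     (\<forall>e\<in>edges H.
        is_path S (P e) \<and> length (path_edges (P e)) \<ge> 1 \<and>
        {hd (P e), last (P e)} = b ` e \<and>
        internal_verts (P e) \<inter> b ` verts H = {}) \<and>
     (\<forall>e\<in>edges H. \<forall>e'\<in>edges H. e \<noteq> e' \<longrightarrow>
        internal_verts (P e) \<inter> internal_verts (P e') = {}) \<and>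
     verts S = b ` verts H \<union> (\<Union>e\<in>edges H. set (P e)) \<and>
     edges S = (\<Union>e\<in>edges H. set (path_edges (P e)))"

section \<open>Edge weights in the cyclic group of order \<open>q\<close>\<close>

text \<open>
  The cyclic group of order \<open>q\<close> is represented by the residues \<open>{0..<q}\<close> with addition
  modulo \<open>q\<close>. Values of a weight function outside the edge set are irrelevant.
\<close>

definition edge_weighting :: "nat \<Rightarrow> 'a graph \<Rightarrow> ('a set \<Rightarrow> int) \<Rightarrow> bool" where
  "edge_weighting q G w \<longleftrightarrow> (\<forall>e\<in>edges G. w e \<in> {0..<int q})"

definition path_weight :: "nat \<Rightarrow> ('a set \<Rightarrow> int) \<Rightarrow> 'a list \<Rightarrow> int" where
  "path_weight q w p = (\<Sum>e\<leftarrow>path_edges p. w e) mod int q"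

definition has_divisible_subdivision ::
    "nat \<Rightarrow> 'a graph \<Rightarrow> 'b graph \<Rightarrow> ('b set \<Rightarrow> int) \<Rightarrow> bool" where
  "has_divisible_subdivision q H G w \<longleftrightarrow>
     (\<exists>S b P. subgraph S G \<and> subdivision_via H S b P \<and>
        (\<forall>e\<in>edges H. path_weight q w (P e) = 0))"

definition forces_divisible_subdivision :: "nat \<Rightarrow> 'a graph \<Rightarrow> nat \<Rightarrow> bool" where
  "forces_divisible_subdivision q H f \<longleftrightarrow>
     (\<forall>w. edge_weighting q (complete_K f) w \<longrightarrow> has_divisible_subdivision q H (complete_K f) w)"

text \<open>
  The minimum is taken in \<^typ>\<open>enat\<close>, where the infimum of the empty set is \<open>\<infinity>\<close>; hence a finite
  upper bound on \<open>s_num q H\<close> includes the claim that some \<open>f\<close> has the required property.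
\<close>

definition s_num :: "nat \<Rightarrow> 'a graph \<Rightarrow> enat" where
  "s_num q H = Inf {enat f | f. forces_divisible_subdivision q H f}"

lemma s_num_eq_Least:
  assumes "\<exists>f. forces_divisible_subdivision q H f"
  shows "s_num q H = enat (LEAST f. forces_divisible_subdivision q H f)"
  unfolding s_num_def
proof (rule antisym)
  show "Inf {enat f | f. forces_divisible_subdivision q H f}
      \<le> enat (LEAST f. forces_divisible_subdivision q H f)"
    using LeastI_ex[OF assms] by (auto intro: Inf_lower)
  show "enat (LEAST f. forces_divisible_subdivision q H f)
      \<le> Inf {enat f | f. forces_divisible_subdivision q H f}"
    by (auto intro!: Inf_greatest Least_le)
qed

end

theory Submission
  imports Defs "HOL-Library.Disjoint_Sets"
begin

text \<open>
  The construction prepares one flexible vertex set per edge of \<open>H\<close> before it chooses the branch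
  vertices. Throughout, a subgroup of the cyclic group of order \<open>q\<close> is represented by its generator
  \<open>g\<close>, a divisor of \<open>q\<close>; its order is \<open>k = q / g\<close>. The invariant is that, on the set \<open>R\<close> of
  vertices still free, every triangle satisfies \<open>w(xy) + w(yz) = w(xz)\<close> modulo \<open>g\<close>
  (\<open>triangular w R g\<close>). It holds for \<open>g = 1\<close>, and it makes the weight of every path in \<open>R\<close> equal,
  modulo \<open>g\<close>, to the weight of the edge between its ends.

  Take a chain of vertices ending in \<open>t\<close> and consider all weights that paths along it attain modulo
  \<open>q\<close>. Appending two free vertices \<open>x, y\<close> offers the choice between the steps \<open>t y\<close> and
  \<open>t x y\<close>. Either this enlarges the set \<open>A\<close> of attained weights, or \<open>A\<close> is invariant under
  translation by \<open>w(tx) + w(xy) - w(ty)\<close>. After at most \<open>k - 1\<close> enlargements, using \<open>2 k - 1\<close>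
  vertices in all, \<open>A\<close> is a full coset of the subgroup. The chain then joins any two free vertices
  whose edge has weight \<open>0\<close> modulo \<open>g\<close> by a path of weight exactly \<open>0\<close>. If the growth gets stuck
  earlier, with \<open>A\<close> smaller than a coset, then all those differences lie in the stabilizer of \<open>A\<close>,
  a proper subgroup with generator \<open>g'\<close>, and combining three of the relations shows that the
  invariant holds for \<open>g'\<close> on what remains (\<open>grow_or_refine\<close>). The stuck chain is thrown away.
  The chains completed before stay useful, because a weight divisible by \<open>g'\<close> is divisible by \<open>g\<close>.

  Every discarded chain at least halves the order \<open>k\<close>, so that fewer than
  \<open>2 q + q + q / 2 + \<dots> < 4 q\<close> vertices are discarded, while the \<open>m\<close> completed chains take at most
  \<open>(2 q - 1) m\<close> (\<open>many_connectors\<close>). The remaining \<open>2 n\<close> vertices split into two classes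
  inside which all weights vanish modulo the final \<open>g\<close>, since the invariant forces the weights of the
  edges of a triangle to be \<open>0\<close> or of order two (\<open>balanced_class\<close>). The branch vertices are \<open>n\<close> members of the larger
  class, and each edge of \<open>H\<close> is routed through its own chain.
\<close>

section \<open>Weights of paths and the triangle relation\<close>

abbreviation weight :: "('v set \<Rightarrow> int) \<Rightarrow> 'v list \<Rightarrow> int" where
  "weight w p \<equiv> (\<Sum>e\<leftarrow>path_edges p. w e)"

definition triangular :: "('v set \<Rightarrow> int) \<Rightarrow> 'v set \<Rightarrow> int \<Rightarrow> bool" where
  "triangular w R g \<longleftrightarrow> (\<forall>x\<in>R. \<forall>y\<in>R. \<forall>z\<in>R. x \<noteq> y \<longrightarrow> y \<noteq> z \<longrightarrow> x \<noteq> z \<longrightarrow>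
     g dvd w {x, y} + w {y, z} - w {x, z})"

definition route :: "'v set \<Rightarrow> 'v \<Rightarrow> 'v \<Rightarrow> 'v list \<Rightarrow> bool" where
  "route T s t p \<longleftrightarrow> p \<noteq> [] \<and> distinct p \<and> set p \<subseteq> T \<and> hd p = s \<and> last p = t"

text \<open>Representatives are taken in \<open>{0..<q}\<close>, so that cardinalities count residue classes.\<close>

definition attained :: "('v set \<Rightarrow> int) \<Rightarrow> int \<Rightarrow> 'v set \<Rightarrow> 'v \<Rightarrow> 'v \<Rightarrow> int set" where
  "attained w q T s t = {weight w p mod q | p. route T s t p}"

text \<open>
  The generator \<open>g\<close> enters only through the pairs \<open>u, v\<close> that are to be served: \<open>g dvd w {u, v}\<close>
  is what remains of the requirement that \<open>u\<close> and \<open>v\<close> lie in one class. This makes a connector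
  survive every later refinement of \<open>g\<close> and shrinking of \<open>R\<close>.
\<close>

definition connector :: "('v set \<Rightarrow> int) \<Rightarrow> int \<Rightarrow> 'v set \<Rightarrow> int \<Rightarrow> 'v set \<Rightarrow> bool" where
  "connector w q R g T \<longleftrightarrow> (\<forall>u\<in>R. \<forall>v\<in>R. u \<noteq> v \<longrightarrow> g dvd w {u, v} \<longrightarrow>
     (\<exists>p. p \<noteq> [] \<and> distinct p \<and> set p \<subseteq> T \<and> q dvd weight w (u # p @ [v])))"

lemma connector_mono:
  assumes "connector w q R g T" "R' \<subseteq> R" "g dvd g'"
  shows "connector w q R' g' T"
  using assms unfolding connector_def by (meson dvd_trans subsetD)

lemma triangular_mono: "triangular w R g \<Longrightarrow> R' \<subseteq> R \<Longrightarrow> triangular w R' g"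
  unfolding triangular_def by blast

lemma path_edges_Cons: "p \<noteq> [] \<Longrightarrow> path_edges (u # p) = {u, hd p} # path_edges p"
  by (cases p) auto

lemma path_edges_snoc: "p \<noteq> [] \<Longrightarrow> path_edges (p @ [v]) = path_edges p @ [{last p, v}]"
  by (induction p rule: path_edges.induct) auto

lemma path_edges_subset:
  assumes "distinct p" "e \<in> set (path_edges p)"
  shows "\<exists>u v. u \<in> set p \<and> v \<in> set p \<and> u \<noteq> v \<and> e = {u, v}"
  using assms
proof (induction p rule: path_edges.induct)
  case (1 u v p)
  show ?case
  proof (cases "e = {u, v}")
    case True
    with 1 show ?thesis by (intro exI[of _ u] exI[of _ v]) auto
  next
    case False
    with 1 obtain x y where "x \<in> set (v # p)" "y \<in> set (v # p)" "x \<noteq> y" "e = {x, y}" by auto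
    then show ?thesis by (intro exI[of _ x] exI[of _ y]) auto
  qed
qed auto

text \<open>
  Replacing the first two edges of a path by the edge that closes the triangle does not change the
  weight modulo \<open>g\<close>, and this can be repeated until a single edge is left.
\<close>

lemma triangular_path:
  assumes "triangular w R g" "p \<noteq> []" "distinct p" "set p \<subseteq> R" "hd p \<noteq> last p"
  shows "g dvd weight w p - w {hd p, last p}"
  using assms(2-)
proof (induction p)
  case Nil
  then show ?case by simp
next
  case (Cons u p)
  then have p: "p \<noteq> []" by (cases p) auto
  show ?case
  proof (cases "hd p = last p")
    case True
    with p Cons.prems(2) have "p = [hd p]"
      by (cases p) (auto split: if_splits)
    then obtain v where "p = [v]" by blast
    then show ?thesis by simp
  next
    case False
    have 1: "g dvd weight w p - w {hd p, last p}"
      using Cons p False by simp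
    have "hd p \<in> R" "last p \<in> R" "u \<in> R" "u \<noteq> hd p" "u \<noteq> last p"
      using Cons.prems p by auto
    then have "g dvd w {u, hd p} + w {hd p, last p} - w {u, last p}"
      using assms(1) False unfolding triangular_def by blast
    from dvd_add[OF 1 this] show ?thesis
      using p by (simp add: path_edges_Cons algebra_simps)
  qed
qed

text \<open>
  All paths between the same ends have the weight of one edge modulo \<open>g\<close>; if the ends coincide, there
  is only the path without edges. So attained weights never leave a single coset of the subgroup.
\<close>

lemma attained_cong:
  assumes "triangular w R g" "T \<subseteq> R" "g dvd q" "a \<in> attained w q T s t" "b \<in> attained w q T s t"
  shows "g dvd a - b"
proof -
  obtain p p' where p: "route T s t p" "a = weight w p mod q"
    and p': "route T s t p'" "b = weight w p' mod q"
    using assms(4,5) unfolding attained_def by blast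
  have single: "r = [s]" if "route T s t r" "s = t" for r
    using that by (cases r) (auto simp: route_def split: if_splits)
  have "g dvd weight w p - weight w p'"
  proof (cases "s = t")
    case True
    show ?thesis using single[OF p(1) True] single[OF p'(1) True] by simp
  next
    case False
    have "g dvd weight w p - w {s, t}" "g dvd weight w p' - w {s, t}"
      using triangular_path[OF assms(1), of p] triangular_path[OF assms(1), of p'] False p p' assms(2)
      unfolding route_def by auto
    from dvd_diff[OF this] show ?thesis by simp
  qed
  then show ?thesis
    using assms(3) p(2) p'(2) by (simp add: mod_eq_dvd_iff[symmetric] mod_mod_cancel)
qed

section \<open>Sets of residues and their stabilizers\<close>

text \<open>A coset of the subgroup has only \<open>k\<close> elements, so \<open>k\<close> elements of it exhaust it.\<close>

lemma full_coset:
  fixes A :: "int set" and g q :: int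
  assumes A: "A \<subseteq> {0..<q}" and c: "\<And>a b. a \<in> A \<Longrightarrow> b \<in> A \<Longrightarrow> g dvd a - b"
    and q: "q = g * int k" "g > 0" and card: "card A \<ge> k" and a: "a \<in> A" and r: "g dvd r - a" and k: "k > 0"
  shows "r mod q \<in> A"
proof -
  define C where "C = {z \<in> {0..<q}. z mod g = a mod g}"
  have fin: "finite C" unfolding C_def by (rule finite_subset[of _ "{0..<q}"]) auto
  have sub: "A \<subseteq> C" using A c[OF _ a] by (auto simp: C_def mod_eq_dvd_iff)
  have "inj_on (\<lambda>z. z div g) C"
    by (rule inj_onI) (metis (mono_tags, lifting) C_def div_mult_mod_eq mem_Collect_eq)
  moreover have "(\<lambda>z. z div g) ` C \<subseteq> {0..<int k}"
  proof (intro image_subsetI)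
    fix z assume z: "z \<in> C"
    have "0 \<le> z div g" using z q(2) by (simp add: C_def pos_imp_zdiv_nonneg_iff)
    moreover have "g * (z div g) < g * int k"
    proof -
      have "g * (z div g) \<le> z"
        using mult_div_mod_eq[of g z] pos_mod_sign[OF q(2), of z] by linarith
      also have "z < g * int k" using z q(1) by (simp add: C_def)
      finally show ?thesis .
    qed
    ultimately show "z div g \<in> {0..<int k}" using q(2) by simp
  qed
  ultimately have "card C \<le> card {0..<int k}"
    by (intro card_inj_on_le[of "\<lambda>z. z div g"]) auto
  then have "A = C"
    using card_seteq[OF fin sub] card by simp
  moreover have "r mod q \<in> C"
  proof -
    have "(r mod q) mod g = r mod g" using q(1) by (simp add: mod_mod_cancel)
    also have "\<dots> = a mod g" using r by (simp add: mod_eq_dvd_iff)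
    finally show ?thesis using q k by (simp add: C_def)
  qed
  ultimately show ?thesis by simp
qed

text \<open>
  The translations in the subgroup generated by \<open>g\<close> that preserve \<open>A\<close> form a subgroup of the integers
  containing \<open>q\<close>, and \<open>g'\<close> is its generator. It is not \<open>g\<close> itself: the translates of one element
  by all multiples of \<open>g\<close> would be \<open>k\<close> distinct elements of \<open>A\<close>.
\<close>

lemma stabilizer_generator:
  fixes A :: "int set" and g q :: int
  assumes A: "A \<subseteq> {0..<q}" "A \<noteq> {}" and q: "q = g * int k" "g > 0" and card: "card A < k"
  obtains g' where "g dvd g'" "g' dvd q" "g' \<noteq> g" "g' > 0"
    "\<And>d. g dvd d \<Longrightarrow> (\<And>a. a \<in> A \<Longrightarrow> (a + d) mod q \<in> A) \<Longrightarrow> g' dvd d"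
proof -
  define L where "L = {d. g dvd d \<and> (\<forall>a\<in>A. (a + d) mod q \<in> A)}"
  have q0: "q > 0" using q card by simp
  have mod_id: "a mod q = a" if "a \<in> A" for a using that A by auto
  have add: "d + e \<in> L" if "d \<in> L" "e \<in> L" for d e
  proof -
    have "(a + (d + e)) mod q \<in> A" if "a \<in> A" for a
    proof -
      have "((a + d) mod q + e) mod q \<in> A" using \<open>d \<in> L\<close> \<open>e \<in> L\<close> that unfolding L_def by blast
      then show ?thesis by (simp add: mod_simps add.assoc)
    qed
    with that show ?thesis unfolding L_def by auto
  qed
  have qmult: "q * z \<in> L" for z
    using mod_id q by (auto simp: L_def)
  have nmult: "int i * d \<in> L" if "d \<in> L" for i d
  proof (induction i)
    case 0
    then show ?case using qmult[of 0] by simp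
  next
    case (Suc i)
    then show ?case using add[OF that Suc] by (simp add: algebra_simps)
  qed
  \<comment> \<open>Negative multiples are reached by shifting the factor by a multiple of \<open>q\<close>.\<close>
  have zmult: "z * d \<in> L" if "d \<in> L" for z d
  proof -
    have "int (nat (z mod q)) * d + q * (z div q * d) \<in> L"
      by (intro add nmult qmult that)
    moreover have "int (nat (z mod q)) * d + q * (z div q * d) = z * d"
      using q0 by (simp add: distrib_right[symmetric] mult.assoc[symmetric])
    ultimately show ?thesis by simp
  qed
  define h where "h = (LEAST i. i > 0 \<and> int i \<in> L)"
  have ex: "nat q > 0 \<and> int (nat q) \<in> L" using q0 qmult[of 1] by simp
  have h: "h > 0" "int h \<in> L"
    using LeastI[of "\<lambda>i. i > 0 \<and> int i \<in> L", OF ex] unfolding h_def by auto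
  have gen: "int h dvd d" if "d \<in> L" for d
  proof (rule ccontr)
    assume nd: "\<not> int h dvd d"
    have "d + (- (d div int h)) * int h \<in> L" by (intro add zmult that h)
    moreover have "d + (- (d div int h)) * int h = d mod int h"
      by (simp add: minus_mult_div_eq_mod[symmetric] mult.commute)
    ultimately have m: "d mod int h \<in> L" by simp
    have hpos: "int h > 0" using h(1) by simp
    have "d mod int h \<noteq> 0" using nd by (metis dvd_eq_mod_eq_0)
    moreover have "d mod int h < int h" "0 \<le> d mod int h"
      using pos_mod_bound[OF hpos] pos_mod_sign[OF hpos] by blast+
    ultimately have "d mod int h > 0" "d mod int h < int h" by linarith+
    then have "h \<le> nat (d mod int h)"
      using m Least_le[of "\<lambda>i. i > 0 \<and> int i \<in> L" "nat (d mod int h)"] by (simp add: h_def[symmetric])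
    with \<open>d mod int h < int h\<close> h show False by linarith
  qed
  have "g \<notin> L"
  proof
    assume gL: "g \<in> L"
    obtain a where a: "a \<in> A" using A by blast
    let ?f = "\<lambda>i. (a + int i * g) mod q"
    have "?f ` {..<k} \<subseteq> A" using nmult[OF gL] a unfolding L_def by auto
    moreover have "inj_on ?f {..<k}"
    proof (rule inj_onI)
      fix i j assume ij: "i \<in> {..<k}" "j \<in> {..<k}" "?f i = ?f j"
      then have "g * int k dvd g * (int i - int j)"
        using q by (simp add: mod_eq_dvd_iff algebra_simps)
      then have "int k dvd int i - int j" using q by simp
      then show "i = j" using ij
        by (metis lessThan_iff mod_eq_dvd_iff mod_less of_nat_eq_iff zmod_int)
    qed
    moreover have "finite A" using A finite_subset by blast
    ultimately have "k \<le> card A" using card_inj_on_le[of ?f "{..<k}" A] by simp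
    with card show False by simp
  qed
  show ?thesis
  proof (rule that)
    show "g dvd int h" using h unfolding L_def by simp
    show "int h dvd q" using gen qmult[of 1] by simp
    show "int h \<noteq> g" using \<open>g \<notin> L\<close> h by auto
    show "int h > 0" using h by simp
    show "int h dvd d" if "g dvd d" "\<And>a. a \<in> A \<Longrightarrow> (a + d) mod q \<in> A" for d
      using gen that unfolding L_def by blast
  qed
qed

text \<open>
  If two translates of \<open>A\<close> fit into a set no larger than \<open>A\<close>, then both are equal to that set, so the
  difference of the two shifts preserves \<open>A\<close>.
\<close>

lemma translate_difference_stable:
  fixes A :: "int set"
  assumes A: "A \<subseteq> {0..<q}" and B: "finite B"
    and \<alpha>: "\<And>a. a \<in> A \<Longrightarrow> (a + \<alpha>) mod q \<in> B" and \<beta>: "\<And>a. a \<in> A \<Longrightarrow> (a + \<beta>) mod q \<in> B"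
    and card: "card B \<le> card A" and a: "a \<in> A"
  shows "(a + (\<beta> - \<alpha>)) mod q \<in> A"
proof -
  let ?f = "\<lambda>a. (a + \<alpha>) mod q"
  have "inj_on ?f A"
  proof (rule inj_onI)
    fix x y assume "x \<in> A" "y \<in> A" "?f x = ?f y"
    then have "q dvd x - y" by (simp add: mod_eq_dvd_iff)
    then have "x mod q = y mod q" by (simp add: mod_eq_dvd_iff)
    moreover have "x mod q = x" "y mod q = y" using A \<open>x \<in> A\<close> \<open>y \<in> A\<close> by auto
    ultimately show "x = y" by simp
  qed
  then have "?f ` A = B"
    using card_seteq[OF B, of "?f ` A"] \<alpha> card by (auto simp: card_image)
  then obtain b where b: "b \<in> A" "(a + \<beta>) mod q = (b + \<alpha>) mod q"
    using \<beta>[OF a] by blast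
  then have "(a + (\<beta> - \<alpha>)) mod q = b mod q"
    by (simp add: mod_eq_dvd_iff algebra_simps)
  then show ?thesis using b A by auto
qed

section \<open>Growing a chain\<close>

text \<open>The two ways of reaching \<open>y\<close> from \<open>t\<close>, directly or through \<open>x\<close>, give two translates.\<close>

lemma attained_extend:
  assumes "t \<in> T" "x \<notin> T" "y \<notin> T" "x \<noteq> y" "a \<in> attained w q T s t"
  shows "(a + w {t, y}) mod q \<in> attained w q (insert x (insert y T)) s y"
    and "(a + (w {t, x} + w {x, y})) mod q \<in> attained w q (insert x (insert y T)) s y"
proof -
  obtain p where p: "route T s t p" "a = weight w p mod q"
    using assms(5) unfolding attained_def by blast
  have r: "p \<noteq> []" "last p = t" using p unfolding route_def by auto
  have "route (insert x (insert y T)) s y (p @ [y])"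
    "route (insert x (insert y T)) s y (p @ [x] @ [y])"
    using p(1) assms unfolding route_def by auto
  moreover have "weight w (p @ [y]) = weight w p + w {t, y}"
    using r by (simp add: path_edges_snoc)
  moreover have "weight w (p @ [x] @ [y]) = weight w p + (w {t, x} + w {x, y})"
    using r path_edges_snoc[of p x] path_edges_snoc[of "p @ [x]" y] by simp
  ultimately show "(a + w {t, y}) mod q \<in> attained w q (insert x (insert y T)) s y"
    "(a + (w {t, x} + w {x, y})) mod q \<in> attained w q (insert x (insert y T)) s y"
    unfolding attained_def p(2) mod_add_left_eq by (metis (mono_tags, lifting) mem_Collect_eq)+
qed

text \<open>
  One step of the construction, by induction on the number \<open>j\<close> of enlargements asked for. A chain
  whose attained set cannot be enlarged by any two free vertices leads to the second alternative: its
  end \<open>t\<close> relates \<open>w(xy)\<close> to \<open>w(ty) - w(tx)\<close> modulo the stabilizer's generator \<open>g'\<close>, and these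
  differences add up along triangles.
\<close>

lemma grow_or_refine:
  fixes w :: "'v set \<Rightarrow> int"
  assumes tri: "triangular w R g" and R: "R \<noteq> {}" "finite R" and q: "q = g * int k" "g > 0" and "j < k"
  shows "(\<exists>T s t. T \<subseteq> R \<and> s \<in> T \<and> t \<in> T \<and> card T \<le> 2 * j + 1 \<and> j + 1 \<le> card (attained w q T s t))
    \<or> (\<exists>T g'. T \<subseteq> R \<and> card T \<le> 2 * k - 2 \<and> g dvd g' \<and> g' dvd q \<and> g' \<noteq> g \<and> g' > 0 \<and>
          triangular w (R - T) g')"
  using \<open>j < k\<close>
proof (induction j)
  case 0
  obtain s where s: "s \<in> R" using R by blast
  have "route {s} s s [s]" by (simp add: route_def)
  moreover have "p = [s]" if "route {s} s s p" for p
    using that by (cases p) (auto simp: route_def split: if_splits)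
  ultimately have "attained w q {s} s s = {0}"
    unfolding attained_def by force
  then show ?case using s
    by (intro disjI1 exI[of _ "{s}"] exI[of _ s]) auto
next
  case (Suc j)
  have q0: "q > 0" using q Suc.prems by simp
  from Suc consider (ref) "\<exists>T g'. T \<subseteq> R \<and> card T \<le> 2 * k - 2 \<and> g dvd g' \<and> g' dvd q \<and> g' \<noteq> g \<and> g' > 0 \<and>
          triangular w (R - T) g'"
    | (grow) T s t where "T \<subseteq> R" "s \<in> T" "t \<in> T" "card T \<le> 2 * j + 1" "j + 1 \<le> card (attained w q T s t)"
    by fastforce
  then show ?case
  proof cases
    case ref
    then show ?thesis by blast
  next
    case grow
    let ?A = "attained w q T s t"
    let ?B = "\<lambda>x y. attained w q (insert x (insert y T)) s y"
    have range: "attained w q T' s' t' \<subseteq> {0..<q}" for T' s' t'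
      using q0 by (auto simp: attained_def)
    have fT: "finite T" using grow R finite_subset by blast
    show ?thesis
    proof (cases "j + 2 \<le> card ?A")
      case True
      then show ?thesis using grow
        by (intro disjI1 exI[of _ T] exI[of _ s] exI[of _ t]) auto
    next
      case False
      then have cA: "card ?A = j + 1" using grow by simp
      show ?thesis
      proof (cases "\<exists>x\<in>R - T. \<exists>y\<in>R - T. x \<noteq> y \<and> card ?A < card (?B x y)")
        case True
        then obtain x y where "x \<in> R - T" "y \<in> R - T" "x \<noteq> y" "card ?A < card (?B x y)" by blast
        then show ?thesis using grow cA fT
          by (intro disjI1 exI[of _ "insert x (insert y T)"] exI[of _ s] exI[of _ y]) auto
      next
        case stuck: False
        have "?A \<noteq> {}" using cA by auto
        moreover have "card ?A < k" using cA Suc.prems by simp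
        ultimately obtain g' where g': "g dvd g'" "g' dvd q" "g' \<noteq> g" "g' > 0"
          "\<And>d. g dvd d \<Longrightarrow> (\<And>a. a \<in> ?A \<Longrightarrow> (a + d) mod q \<in> ?A) \<Longrightarrow> g' dvd d"
          using stabilizer_generator[OF range _ q] by metis
        have d: "g' dvd w {t, x} + w {x, y} - w {t, y}" 
          if xy: "x \<in> R - T" "y \<in> R - T" "x \<noteq> y" for x y
        proof (rule g'(5))
          have "t \<in> R" "t \<noteq> x" "t \<noteq> y" using xy grow by auto
          then show "g dvd w {t, x} + w {x, y} - w {t, y}"
            using tri xy unfolding triangular_def by blast
          show "(a + (w {t, x} + w {x, y} - w {t, y})) mod q \<in> ?A" if a: "a \<in> ?A" for a
          proof (rule translate_difference_stable[OF range _ _ _ _ a])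
            show "finite (?B x y)" by (rule finite_subset[OF range]) simp
            show "card (?B x y) \<le> card ?A" using stuck xy by (meson not_less)
            show "(b + w {t, y}) mod q \<in> ?B x y" "(b + (w {t, x} + w {x, y})) mod q \<in> ?B x y"
              if "b \<in> ?A" for b
              using attained_extend[OF grow(3) _ _ xy(3) that] xy by auto
          qed
        qed
        \<comment> \<open>The relations for \<open>xy\<close>, \<open>yz\<close> and \<open>xz\<close> combine so that all edges at \<open>t\<close> cancel.\<close>
        have "triangular w (R - T) g'"
          unfolding triangular_def
        proof (intro ballI impI)
          fix x y z assume *: "x \<in> R - T" "y \<in> R - T" "z \<in> R - T" "x \<noteq> y" "y \<noteq> z" "x \<noteq> z"
          have "g' dvd (w {t, x} + w {x, y} - w {t, y}) + (w {t, y} + w {y, z} - w {t, z})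
              - (w {t, x} + w {x, z} - w {t, z})"
            using * by (intro dvd_add dvd_diff d)
          then show "g' dvd w {x, y} + w {y, z} - w {x, z}" by (simp add: algebra_simps)
        qed
        moreover have "card T \<le> 2 * k - 2" using grow Suc.prems by simp
        ultimately show ?thesis using g'(1-4) grow by blast
      qed
    qed
  qed
qed

text \<open>
  The path from \<open>u\<close> through the chain to \<open>v\<close> has weight \<open>w(uv)\<close>, that is \<open>0\<close>, modulo \<open>g\<close>. Hence
  the value that the chain must contribute to make the total \<open>0\<close> modulo \<open>q\<close> lies in the coset of the
  attained weights, all of which are available.
\<close>

lemma full_chain_connector:
  assumes tri: "triangular w R g" and q: "q = g * int k" "g > 0" "k > 0"
    and T: "T \<subseteq> R" and card: "k \<le> card (attained w q T s t)"
  shows "connector w q (R - T) g T"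
  unfolding connector_def
proof (intro ballI impI)
  fix u v assume uv: "u \<in> R - T" "v \<in> R - T" "u \<noteq> v" "g dvd w {u, v}"
  let ?A = "attained w q T s t"
  have q0: "q > 0" using q by simp
  have range: "?A \<subseteq> {0..<q}" using q0 by (auto simp: attained_def)
  have "?A \<noteq> {}" using card q by auto
  then obtain p0 where p0: "route T s t p0" "weight w p0 mod q \<in> ?A"
    unfolding attained_def by blast
  have full: "weight w (u # p @ [v]) = w {u, s} + weight w p + w {t, v}" if "route T s t p" for p
    using that by (auto simp: route_def path_edges_Cons path_edges_snoc)
  have "g dvd weight w (u # p0 @ [v]) - w {hd (u # p0 @ [v]), last (u # p0 @ [v])}"
    using p0(1) uv T by (intro triangular_path[OF tri]) (auto simp: route_def)
  then have "g dvd w {u, s} + weight w p0 + w {t, v} - w {u, v}"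
    using full[OF p0(1)] by simp
  from dvd_add[OF this uv(4)] have 1: "g dvd w {u, s} + weight w p0 + w {t, v}" by simp
  let ?r = "- (w {u, s} + w {t, v})"
  have "g dvd ?r - weight w p0"
    using 1 by (subst dvd_minus_iff[symmetric]) (simp add: algebra_simps)
  then have "?r mod g = (weight w p0 mod q) mod g"
    using q by (simp add: mod_eq_dvd_iff mod_mod_cancel)
  then have "g dvd ?r - weight w p0 mod q" by (simp add: mod_eq_dvd_iff)
  then have "?r mod q \<in> ?A"
  proof (intro full_coset[OF range _ q(1,2) card p0(2) _ q(3)])
    show "g dvd a - b" if "a \<in> ?A" "b \<in> ?A" for a b
      using attained_cong[OF tri T _ that] q(1) by simp
  qed
  then obtain p where p: "route T s t p" "?r mod q = weight w p mod q"
    unfolding attained_def by blast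
  then have "q dvd ?r - weight w p" by (simp add: mod_eq_dvd_iff)
  moreover have "w {u, s} + weight w p + w {t, v} = - (?r - weight w p)" by simp
  ultimately have "q dvd w {u, s} + weight w p + w {t, v}" by (simp only: dvd_minus_iff)
  then show "\<exists>p. p \<noteq> [] \<and> distinct p \<and> set p \<subseteq> T \<and> q dvd weight w (u # p @ [v])"
    using p(1) full[OF p(1)] by (auto simp: route_def intro!: exI[of _ p])
qed

section \<open>Collecting the connectors\<close>

text \<open>
  The reserve \<open>4 * k - 1\<close> pays for discarded chains: one of them costs at most \<open>2 * k - 2\<close> vertices
  and at least halves \<open>k\<close>, which frees at least \<open>2 * k\<close> of the reserve. Hence the outer induction on \<open>k\<close> for
  refinements and the inner one on \<open>E\<close> for completed chains. The number \<open>l\<close> of vertices left over is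
  arbitrary.
\<close>

lemma many_connectors:
  fixes w :: "'v set \<Rightarrow> int" and E :: "'e set"
  assumes "finite E" "triangular w R g" "finite R" "q = g * int k" "g > 0" "k > 0"
    and "card R \<ge> (2 * k - 1) * card E + l + (4 * k - 1)"
  shows "\<exists>R' g' T. R' \<subseteq> R \<and> g' > 0 \<and> triangular w R' g' \<and> l \<le> card R' \<and> g dvd g' \<and> g' dvd q \<and>
    (\<forall>e\<in>E. T e \<subseteq> R - R' \<and> connector w q R' g' (T e)) \<and> disjoint_family_on T E"
  using assms
proof (induction k arbitrary: E R g rule: less_induct)
  case outer: (less k)
  from outer.prems show ?case
  proof (induction E arbitrary: R rule: finite_induct)
    case empty
    then show ?case
      by (intro exI[of _ R] exI[of _ g]) (auto simp: disjoint_family_on_def)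
  next
    case (insert e E)
    have "R \<noteq> {}" using insert.prems by auto
    have cE: "card (insert e E) = Suc (card E)" using insert by simp
    from insert.prems have k1: "k - 1 < k" by simp
    from grow_or_refine[OF insert.prems(1) \<open>R \<noteq> {}\<close> insert.prems(2,3,4) k1]
    consider (grow) T s t where "T \<subseteq> R" "card T \<le> 2 * (k - 1) + 1" "k - 1 + 1 \<le> card (attained w q T s t)"
      | (ref) T g' where "T \<subseteq> R" "card T \<le> 2 * k - 2" "g dvd g'" "g' dvd q" "g' \<noteq> g" "g' > 0"
          "triangular w (R - T) g'"
      by blast
    then show ?case
    proof cases
      case grow
      have con: "connector w q (R - T) g T"
        using grow insert.prems by (intro full_chain_connector[of w R g q k]) auto
      have "card (R - T) = card R - card T"
        using grow insert.prems by (meson card_Diff_subset finite_subset)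
      then have "card (R - T) \<ge> (2 * k - 1) * card E + l + (4 * k - 1)"
        using insert.prems(6) grow(2) insert.prems(5) unfolding cE by simp
      from insert.IH[OF triangular_mono[OF insert.prems(1)] _ insert.prems(3-5) this] insert.prems(2)
      obtain R' g' T' where IH: "R' \<subseteq> R - T" "g' > 0" "triangular w R' g'" "l \<le> card R'" "g dvd g'" "g' dvd q"
        "\<forall>e\<in>E. T' e \<subseteq> R - T - R' \<and> connector w q R' g' (T' e)" "disjoint_family_on T' E"
        by (metis Diff_subset finite_Diff)
      have "connector w q R' g' T" using connector_mono[OF con IH(1,5)] .
      moreover have "disjoint_family_on (T'(e := T)) (insert e E)"
        using IH(7,8) insert.hyps unfolding disjoint_family_on_def by (auto; blast)
      moreover have "\<forall>i\<in>insert e E. (T'(e := T)) i \<subseteq> R - R' \<and> connector w q R' g' ((T'(e := T)) i)"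
        using IH(1,7) grow(1) \<open>connector w q R' g' T\<close> by auto
      ultimately show ?thesis using IH(1-6) by blast
    next
      case ref
      obtain c where c: "q = g' * c" using ref by blast
      have "q > 0" using insert.prems by simp
      then have c0: "c > 0" using c ref(6) by (simp add: zero_less_mult_iff)
      obtain b where b: "g' = g * b" using ref by blast
      have "b > 0" using b ref(6) insert.prems(4) by (simp add: zero_less_mult_iff)
      moreover have "b \<noteq> 1" using b ref(5) by simp
      ultimately have "b \<ge> 2" by simp
      have "int k = b * c" using c b insert.prems(3,4) by simp
      with \<open>b \<ge> 2\<close> c0 have k2: "2 * c \<le> int k" by simp
      have kk: "2 * nat c \<le> k" using k2 by simp
      have "card (R - T) = card R - card T"
        using ref insert.prems by (meson card_Diff_subset finite_subset)
      moreover have "(2 * nat c - 1) * card (insert e E) \<le> (2 * k - 1) * card (insert e E)"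
        using kk by (intro mult_right_mono) auto
      ultimately have "card (R - T) \<ge> (2 * nat c - 1) * card (insert e E) + l + (4 * nat c - 1)"
        using insert.prems(6) ref(2) kk by linarith
      moreover have "q = g' * int (nat c)" "nat c < k" "nat c > 0" using c c0 kk by auto
      ultimately obtain R' g'' T' where IH: "R' \<subseteq> R - T" "g'' > 0" "triangular w R' g''" "l \<le> card R'"
        "g' dvd g''" "g'' dvd q"
        "\<forall>i\<in>insert e E. T' i \<subseteq> R - T - R' \<and> connector w q R' g'' (T' i)" "disjoint_family_on T' (insert e E)"
        using outer.IH[of "nat c" "insert e E" "R - T" g'] ref insert.prems insert.hyps
        by (metis finite_Diff finite_insert)
      then show ?thesis using ref
        by (intro exI[of _ R'] exI[of _ g''] exI[of _ T']) (auto dest: dvd_trans)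
    qed
  qed
qed

section \<open>Branch vertices and the subdivision\<close>

text \<open>
  Fix \<open>x\<close> and divide the vertices according to whether \<open>w(xy)\<close> vanishes modulo \<open>g\<close>. Within the
  first part, triangles at \<open>x\<close> show that all weights vanish. For \<open>u, v\<close> in the second part, reading
  the triangle \<open>x u v\<close> from different corners gives \<open>2 w(xu) = 2 w(xv) = 0\<close> modulo \<open>g\<close>. A cyclic group
  has at most one element of order two, so \<open>w(xu) = w(xv)\<close> and thus \<open>w(uv) = 0\<close> modulo \<open>g\<close>. The larger part has at least \<open>n\<close> vertices.
\<close>

lemma balanced_class:
  fixes w :: "'v set \<Rightarrow> int"
  assumes tri: "triangular w R g" and R: "finite R" "2 * n \<le> card R + 1" and "g > 0"
  shows "\<exists>X\<subseteq>R. card X = n \<and> (\<forall>u\<in>X. \<forall>v\<in>X. u \<noteq> v \<longrightarrow> g dvd w {u, v})"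
proof (cases "n = 0")
  case True
  then show ?thesis by (intro exI[of _ "{}"]) auto
next
  case False
  then have "R \<noteq> {}" using R by auto
  then obtain x where x: "x \<in> R" by blast
  have T: "g dvd w {a, b} + w {b, c} - w {a, c}"
    if "a \<in> R" "b \<in> R" "c \<in> R" "a \<noteq> b" "b \<noteq> c" "a \<noteq> c" for a b c
    using tri that unfolding triangular_def by blast
  define X where "X = {y \<in> R. y = x \<or> g dvd w {x, y}}"
  define Y where "Y = R - X"
  have X: "g dvd w {u, v}" if "u \<in> X" "v \<in> X" "u \<noteq> v" for u v
  proof (cases "u = x \<or> v = x")
    case True
    then show ?thesis using that by (auto simp: X_def insert_commute)
  next
    case False
    then have "g dvd w {x, u} + w {u, v} - w {x, v}" "g dvd w {x, u}" "g dvd w {x, v}"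
      using T[of x u v] that x by (auto simp: X_def)
    from dvd_add[OF dvd_diff[OF this(1,2)] this(3)] show ?thesis by simp
  qed
  have Y: "g dvd w {u, v}" if "u \<in> Y" "v \<in> Y" "u \<noteq> v" for u v
  proof -
    have uv: "u \<in> R" "v \<in> R" "u \<noteq> x" "v \<noteq> x" "\<not> g dvd w {x, u}" "\<not> g dvd w {x, v}"
      using that by (auto simp: X_def Y_def)
    have half: "a mod g + a mod g = g" if "\<not> g dvd a" "g dvd a + a" for a
    proof -
      have "g dvd a mod g + a mod g"
        using that(2) by (simp add: dvd_eq_mod_eq_0 mod_simps)
      moreover have "a mod g < g" using \<open>g > 0\<close> by simp
      moreover have "0 < a mod g"
        using that(1) pos_mod_sign[OF \<open>g > 0\<close>, of a] by (simp add: dvd_eq_mod_eq_0 order_less_le)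
      moreover obtain z where z: "a mod g + a mod g = g * z"
        using \<open>g dvd a mod g + a mod g\<close> by blast
      ultimately have "0 < g * z" "g * z < g * 2" by linarith+
      then have "0 < z" "z < 2" using \<open>g > 0\<close> by (auto simp: zero_less_mult_iff)
      then show ?thesis using z by simp
    qed
    have t1: "g dvd w {x, u} + w {u, v} - w {x, v}" using T[of x u v] uv x that by auto
    have t2: "g dvd w {x, v} + w {u, v} - w {x, u}" using T[of x v u] uv x that by (auto simp: insert_commute)
    have t3: "g dvd w {x, u} + w {x, v} - w {u, v}" using T[of u x v] uv x that by (auto simp: insert_commute)
    have "w {x, u} mod g + w {x, u} mod g = g"
      using half[OF uv(5)] dvd_add[OF t1 t3] by (simp add: algebra_simps)
    moreover have "w {x, v} mod g + w {x, v} mod g = g"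
      using half[OF uv(6)] dvd_add[OF t2 t3] by (simp add: algebra_simps)
    ultimately have "w {x, v} mod g = w {x, u} mod g" by linarith
    then have "g dvd w {x, v} - w {x, u}" by (simp add: mod_eq_dvd_iff)
    from dvd_add[OF t1 this] show ?thesis by simp
  qed
  have "card X + card Y = card R"
    unfolding Y_def using R card_mono[of R X] by (subst card_Diff_subset) (auto simp: X_def)
  then have "n \<le> card X \<or> n \<le> card Y" using R by linarith
  then show ?thesis
  proof
    assume "n \<le> card X"
    then obtain Z where "Z \<subseteq> X" "card Z = n" by (meson obtain_subset_with_card_n)
    then show ?thesis using X by (intro exI[of _ Z]) (auto simp: X_def)
  next
    assume "n \<le> card Y"
    then obtain Z where "Z \<subseteq> Y" "card Z = n" by (meson obtain_subset_with_card_n)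
    then show ?thesis using Y by (intro exI[of _ Z]) (auto simp: Y_def)
  qed
qed

text \<open>
  Any bijection onto the branch vertices will do, and any orientation of the edges of \<open>H\<close>, since
  a connector serves all pairs of branch vertices. Disjointness of the connectors makes the
  subdivision paths internally disjoint.
\<close>

lemma divisible_subdivision_from_connectors:
  fixes w :: "'v set \<Rightarrow> int" and H :: "'a graph"
  assumes H: "fin_simple_graph H" and V: "finite V"
    and X: "X \<subseteq> V" "card X = card (verts H)" and X0: "\<And>u v. u \<in> X \<Longrightarrow> v \<in> X \<Longrightarrow> u \<noteq> v \<Longrightarrow> g dvd w {u, v}"
    and T: "\<And>e. e \<in> edges H \<Longrightarrow> T e \<subseteq> V - X" "\<And>e. e \<in> edges H \<Longrightarrow> connector w (int q) X g (T e)"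
      "disjoint_family_on T (edges H)"
  shows "has_divisible_subdivision q H (complete_on V) w"
proof -
  have finH: "finite (verts H)" using H by (simp add: fin_simple_graph_def)
  have finX: "finite X" using X V finite_subset by blast
  obtain b where b: "bij_betw b (verts H) X"
    using finite_same_card_bij[OF finH finX] X by metis
  have inj: "inj_on b (verts H)" and im: "b ` verts H = X" using b by (auto simp: bij_betw_def)
  have "\<exists>P. \<exists>u v p. P = u # p @ [v] \<and> {u, v} = b ` e \<and> u \<in> X \<and> v \<in> X \<and> u \<noteq> v \<and> p \<noteq> [] \<and> distinct p \<and>
      set p \<subseteq> T e \<and> int q dvd weight w P" if e: "e \<in> edges H" for e
  proof -
    obtain x y where xy: "e = {x, y}" "x \<in> verts H" "y \<in> verts H" "x \<noteq> y"
      using e H unfolding fin_simple_graph_def complete_on_def by auto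
    have "b x \<in> X" "b y \<in> X" "b x \<noteq> b y" using xy im inj by (auto simp: inj_on_def)
    with T(2)[OF e] X0 obtain p where "p \<noteq> []" "distinct p" "set p \<subseteq> T e"
      "int q dvd weight w (b x # p @ [b y])"
      unfolding connector_def by metis
    moreover have "{b x, b y} = b ` e" using xy by simp
    ultimately show ?thesis
      using \<open>b x \<in> X\<close> \<open>b y \<in> X\<close> \<open>b x \<noteq> b y\<close> by blast
  qed
  then have "\<forall>e\<in>edges H. \<exists>P. \<exists>u v p. P = u # p @ [v] \<and> {u, v} = b ` e \<and> u \<in> X \<and> v \<in> X \<and>
      u \<noteq> v \<and> p \<noteq> [] \<and> distinct p \<and> set p \<subseteq> T e \<and> int q dvd weight w P"
    by blast
  from bchoice[OF this] obtain P where P: "\<And>e. e \<in> edges H \<Longrightarrow> \<exists>u v p. P e = u # p @ [v] \<and> {u, v} = b ` e \<and> u \<in> X \<and> v \<in> X \<and>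
      u \<noteq> v \<and> p \<noteq> [] \<and> distinct p \<and> set p \<subseteq> T e \<and> int q dvd weight w (P e)"
    by blast
  define S where "S = (X \<union> (\<Union>e\<in>edges H. set (P e)), \<Union>e\<in>edges H. set (path_edges (P e)))"
  have Pe: "distinct (P e)" "{hd (P e), last (P e)} = b ` e" "internal_verts (P e) \<subseteq> T e"
    "set (P e) \<subseteq> X \<union> T e" "P e \<noteq> []" "length (path_edges (P e)) \<ge> 1" "int q dvd weight w (P e)"
    if e: "e \<in> edges H" for e
  proof -
    obtain u v p where *: "P e = u # p @ [v]" "{u, v} = b ` e" "u \<in> X" "v \<in> X"
      "u \<noteq> v" "p \<noteq> []" "distinct p" "set p \<subseteq> T e" "int q dvd weight w (P e)"
      using P[OF e] by blast
    then show "distinct (P e)" "{hd (P e), last (P e)} = b ` e" "internal_verts (P e) \<subseteq> T e"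
      "set (P e) \<subseteq> X \<union> T e" "P e \<noteq> []" "length (path_edges (P e)) \<ge> 1" "int q dvd weight w (P e)"
      using T(1)[OF e] by (auto simp: internal_verts_def path_edges_Cons)
  qed
  have setV: "set (P e) \<subseteq> V" if "e \<in> edges H" for e using Pe(4)[OF that] T(1)[OF that] X by auto
  have edge_ends: "\<exists>u v. u \<in> set (P e) \<and> v \<in> set (P e) \<and> u \<noteq> v \<and> f = {u, v}"
    if "e \<in> edges H" "f \<in> set (path_edges (P e))" for e f
    using path_edges_subset[OF Pe(1)] that by blast
  have "fin_simple_graph S"
    unfolding fin_simple_graph_def
  proof
    show "finite (verts S)"
      using setV X V by (intro finite_subset[OF _ V]) (auto simp: S_def)
    show "edges S \<subseteq> edges (complete_on (verts S))"
      using edge_ends by (fastforce simp: S_def complete_on_def)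
  qed
  moreover have "edges S \<subseteq> edges (complete_on V)"
    using edge_ends setV unfolding S_def complete_on_def by (simp; blast)
  ultimately have "subgraph S (complete_on V)"
    using setV X unfolding subgraph_def by (auto simp: S_def complete_on_def)
  moreover have "subdivision_via H S b P"
    unfolding subdivision_via_def
  proof (intro conjI ballI impI)
    fix e assume e: "e \<in> edges H"
    show "is_path S (P e)" using Pe[OF e] e by (auto simp: is_path_def S_def)
    show "internal_verts (P e) \<inter> b ` verts H = {}" using Pe(3)[OF e] T(1)[OF e] im by auto
    show "internal_verts (P e) \<inter> internal_verts (P e') = {}" if "e' \<in> edges H" "e \<noteq> e'" for e'
      using Pe(3)[OF e] Pe(3)[OF that(1)] T(3) e that unfolding disjoint_family_on_def by blast
  qed (use inj im Pe in \<open>auto simp: S_def\<close>)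
  moreover have "path_weight q w (P e) = 0" if "e \<in> edges H" for e
    using Pe(7)[OF that] by (simp add: path_weight_def)
  ultimately show ?thesis unfolding has_divisible_subdivision_def by blast
qed

theorem theorem1p6:
  fixes H :: "'a graph" and n m q :: nat
  assumes "fin_simple_graph H"
    and "card (verts H) = n"
    and "card (edges H) = m"
    and "q \<ge> 2"
  shows "s_num q H \<le> enat ((2 * q - 1) * m + 2 * n + 4 * q - 1)"
proof -
  let ?N = "(2 * q - 1) * m + 2 * n + 4 * q - 1"
  have "finite (edges H)"
  proof (rule finite_subset)
    show "edges H \<subseteq> Pow (verts H)"
      using assms(1) by (auto simp: fin_simple_graph_def complete_on_def)
  qed (use assms(1) in \<open>simp add: fin_simple_graph_def\<close>)
  have "has_divisible_subdivision q H (complete_K ?N) w" for w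
  proof -
    \<comment> \<open>The process starts with the whole group, generated by \<open>1\<close>, for which every weighting is triangular.\<close>
    have "\<exists>R g T. R \<subseteq> {..<?N} \<and> g > 0 \<and> triangular w R g \<and> 2 * n \<le> card R \<and> 1 dvd g \<and> g dvd int q \<and>
      (\<forall>e\<in>edges H. T e \<subseteq> {..<?N} - R \<and> connector w (int q) R g (T e)) \<and> disjoint_family_on T (edges H)"
      using \<open>finite (edges H)\<close> assms(3,4)
      by (intro many_connectors[where k = q]) (auto simp: triangular_def)
    then obtain R g T where R: "R \<subseteq> {..<?N}" "g > 0" "triangular w R g" "2 * n \<le> card R"
      and T: "\<forall>e\<in>edges H. T e \<subseteq> {..<?N} - R \<and> connector w (int q) R g (T e)" "disjoint_family_on T (edges H)"
      by blast
    have "finite R" using R(1) finite_subset by blast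
    then obtain X where X: "X \<subseteq> R" "card X = n" "\<forall>u\<in>X. \<forall>v\<in>X. u \<noteq> v \<longrightarrow> g dvd w {u, v}"
      using balanced_class[OF R(3), of n] R(2,4) by auto
    show ?thesis
      unfolding complete_K_def
    proof (rule divisible_subdivision_from_connectors[OF assms(1), where X = X and g = g and T = T])
      show "connector w (int q) X g (T e)" if "e \<in> edges H" for e
        using connector_mono[OF _ X(1), of w "int q" g "T e" g] T(1) that by simp
      show "T e \<subseteq> {..<?N} - X" if "e \<in> edges H" for e
        using T(1) X(1) that by blast
    qed (use X R T assms(2) in auto)
  qed
  then have "forces_divisible_subdivision q H ?N"
    by (simp add: forces_divisible_subdivision_def)
  then show ?thesis
    unfolding s_num_def by (intro Inf_lower) blast
qed

end
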